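(* Let $S$ be a topological semigroup acting on a completely regular space $X$ endowed with an admissible family of open coverings $\mathcal{O}$, and assume that $K_{S}(x)$ and $D_S(x)$ are nonempty and compact for every $x\in X$. If $K_{S}$ is upper semicontinuous (at every point of $X$) then $K_{S}(x)$ is stable for every $x\in X$. The converse holds if $x\in K_{S}(x)$ for every $x\in X$.
   Context: For coverings $\mathcal{U},\mathcal{V}$ of $X$, $\mathcal{V}\leqslant\frac12\mathcal{U}$ means: for all $V,V'\in\mathcal{V}$ with $V\cap V'\neq\emptyset$ there is $U\in\mathcal{U}$ with $V\cup V'\subset U$. Star: $\mathrm{St}[x,\mathcal{U}]=\bigcup\{U\in\mathcal{U}: x\in U\}$. A family $\mathcal{O}$ of open coverings of $X$ is admissible if (1) for any $\mathcal{U},\mathcal{V}\in\mathcal{O}$ there is $\mathcal{W}\in\mathcal{O}$ with $\mathcal{W}\leqslant\frac12\mathcal{U}$ and $\mathcal{W}\leqslant\frac12\mathcal{V}$; and (2) the stars $\mathrm{St}[x,\mathcal{U}]$, $x\in X$, $\mathcal{U}\in\mathcal{O}$, form a basis for the topology of $X$. An action of $S$ on $X$ is a continuous map $S\times X\to X$, $(s,x)\mapsto sx$, with $s(tx)=(st)x$. For $Y\subset X$: $SY=\{sy:s\in S,y\in Y\}$, $Sx=S\{x\}$. Define $K_{S}(x)=\mathrm{cls}(Sx)$ and $D_{S}(x)=\bigcap_{\mathcal{U}\in\mathcal{O}}\mathrm{cls}(S\,\mathrm{St}[x,\mathcal{U}])$. A subset $Y\subset X$ is stable if for every neighborhood $U$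 of $Y$ and every $y\in Y$ there is $\mathcal{U}\in\mathcal{O}$ such that $S\,\mathrm{St}[y,\mathcal{U}]\subset U$. A function $F$ from $X$ to the set $\mathcal{H}(X)$ of nonempty closed subsets of $X$ is upper semicontinuous at $x$ if for every open $V\subset X$ with $F(x)\subset V$ there is a neighborhood $U$ of $x$ such that $F(y)\subset V$ for every $y\in U$.
   Formalization: Condition (2) of admissibility is taken as: for each x the stars St[x,U] centred at x form a neighbourhood base at x; if the stars are only a basis as a whole, the first implication fails (example on the Sorgenfrey line). *)

theory Defs
  imports "HOL-Analysis.Analysis"
begin

definition open_covering :: "'x::topological_space set set \<Rightarrow> bool" where
  "open_covering \<U> \<longleftrightarrow> (\<forall>U\<in>\<U>. open U) \<and> \<Union>\<U> = UNIV"

definition half_refines :: "'x set set \<Rightarrow> 'x set set \<Rightarrow> bool" where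
  "half_refines \<V> \<U> \<longleftrightarrow>
     (\<forall>V\<in>\<V>. \<forall>V'\<in>\<V>. V \<inter> V' \<noteq> {} \<longrightarrow> (\<exists>U\<in>\<U>. V \<union> V' \<subseteq> U))"

definition star :: "'x \<Rightarrow> 'x set set \<Rightarrow> 'x set" where
  "star x \<U> = \<Union>{U \<in> \<U>. x \<in> U}"

text \<open>
  The stars are required to form a basis of the topology in the sense usual for covering
  uniformities: the stars centred at \<open>x\<close> are a neighbourhood base at \<open>x\<close>.  As all stars are open,
  this makes the stars a topological basis (lemma \<open>admissible_imp_topological_basis\<close> below).
  Requiring only the latter would be too weak: it allows a topology strictly finer than the one of
  the uniformity generated by the coverings, since an open set containing \<open>x\<close> could then contain
  a star \<open>star z \<U>\<close> through \<open>x\<close> without containing any star centred at \<open>x\<close>.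
\<close>
definition admissible :: "'x::topological_space set set set \<Rightarrow> bool" where
  "admissible \<O> \<longleftrightarrow>
     (\<forall>\<U>\<in>\<O>. open_covering \<U>) \<and>
     (\<forall>\<U>\<in>\<O>. \<forall>\<V>\<in>\<O>. \<exists>\<W>\<in>\<O>. half_refines \<W> \<U> \<and> half_refines \<W> \<V>) \<and>
     (\<forall>x W. open W \<and> x \<in> W \<longrightarrow> (\<exists>\<U>\<in>\<O>. star x \<U> \<subseteq> W))"

lemma admissible_imp_topological_basis:
  assumes "admissible \<O>"
  shows "topological_basis {star x \<U> | x \<U>. \<U> \<in> \<O>}"
proof (rule topological_basisI)
  fix B assume "B \<in> {star x \<U> | x \<U>. \<U> \<in> \<O>}"
  then show "open B"
    using assms by (auto simp: admissible_def open_covering_def star_def)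
next
  fix W :: "'a set" and x assume "open W" "x \<in> W"
  then obtain \<U> where "\<U> \<in> \<O>" "star x \<U> \<subseteq> W"
    using assms unfolding admissible_def by blast
  moreover have "x \<in> \<Union>\<U>"
    using assms \<open>\<U> \<in> \<O>\<close> by (simp add: admissible_def open_covering_def)
  then have "x \<in> star x \<U>"
    by (auto simp: star_def)
  ultimately show "\<exists>B\<in>{star x \<U> | x \<U>. \<U> \<in> \<O>}. x \<in> B \<and> B \<subseteq> W"
    by blast
qed

text \<open>The semigroup need not have an identity element.\<close>
definition semigroup_action ::
    "('s::topological_semigroup_mult \<Rightarrow> 'x::topological_space \<Rightarrow> 'x) \<Rightarrow> bool" where
  "semigroup_action act \<longleftrightarrow>
     continuous_on UNIV (\<lambda>(s, x). act s x) \<and>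
     (\<forall>s t x. act s (act t x) = act (s * t) x)"

definition orbit_set :: "('s \<Rightarrow> 'x \<Rightarrow> 'x) \<Rightarrow> 'x set \<Rightarrow> 'x set" where
  "orbit_set act Y = {act s y | s y. y \<in> Y}"

definition orbit_closure :: "('s \<Rightarrow> 'x::topological_space \<Rightarrow> 'x) \<Rightarrow> 'x \<Rightarrow> 'x set" where
  "orbit_closure act x = closure (orbit_set act {x})"

definition prolongation ::
    "('s \<Rightarrow> 'x::topological_space \<Rightarrow> 'x) \<Rightarrow> 'x set set set \<Rightarrow> 'x \<Rightarrow> 'x set" where
  "prolongation act \<O> x = (\<Inter>\<U>\<in>\<O>. closure (orbit_set act (star x \<U>)))"

text \<open>Neighbourhoods are not required to be open.\<close>
definition stable ::
    "('s \<Rightarrow> 'x::topological_space \<Rightarrow> 'x) \<Rightarrow> 'x set set set \<Rightarrow> 'x set \<Rightarrow> bool" where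
  "stable act \<O> Y \<longleftrightarrow>
     (\<forall>U. Y \<subseteq> interior U \<longrightarrow> (\<forall>y\<in>Y. \<exists>\<U>\<in>\<O>. orbit_set act (star y \<U>) \<subseteq> U))"

definition upper_semicontinuous_at ::
    "('x::topological_space \<Rightarrow> 'x set) \<Rightarrow> 'x \<Rightarrow> bool" where
  "upper_semicontinuous_at F x \<longleftrightarrow>
     (\<forall>V. open V \<and> F x \<subseteq> V \<longrightarrow> (\<exists>U. x \<in> interior U \<and> (\<forall>y\<in>U. F y \<subseteq> V)))"

end

theory Submission
  imports Defs
begin

text \<open>
  Write \<open>K x\<close> for \<open>orbit_closure act x\<close>. Acting by a fixed \<open>s\<close> is continuous and maps the
  orbit of \<open>x\<close> into itself, so it maps \<open>K x\<close> into itself, whence \<open>K y \<subseteq> K x\<close> for \<open>y \<in> K x\<close>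
  (lemma \<open>orbit_closure_antimono\<close>).

  If \<open>K\<close> is upper semicontinuous and \<open>K x\<close> lies in an open set \<open>V\<close>, then every \<open>y \<in> K x\<close> has
  \<open>K y \<subseteq> V\<close>, so upper semicontinuity at \<open>y\<close> keeps the orbit closures, and in particular the
  orbits, of all points of a star around \<open>y\<close> inside \<open>V\<close>. This is stability of \<open>K x\<close>.

  Conversely, stability controls only orbits, whereas upper semicontinuity asks for their closures.
  The gap is closed by shrinking \<open>V\<close>: as \<open>K x\<close> is compact and the space is regular, \<open>K x\<close> has an
  open neighbourhood \<open>W\<close> with \<open>closure W \<subseteq> V\<close>. Because \<open>x \<in> K x\<close>, stability applies at \<open>x\<close>
  itself and yields a star around \<open>x\<close> whose orbit lies in \<open>W\<close>; the orbit closures of its points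
  then lie in \<open>closure W\<close>.
\<close>

lemma orbit_set_mono:
  "Y \<subseteq> Z \<Longrightarrow> orbit_set act Y \<subseteq> orbit_set act Z"
  unfolding orbit_set_def by blast

lemma orbit_set_subset_orbit_closures:
  "orbit_set act Y \<subseteq> (\<Union>y\<in>Y. orbit_closure act y)"
proof
  fix z assume "z \<in> orbit_set act Y"
  then obtain y where "y \<in> Y" "z \<in> orbit_set act {y}"
    unfolding orbit_set_def by blast
  moreover have "orbit_set act {y} \<subseteq> orbit_closure act y"
    unfolding orbit_closure_def by (rule closure_subset)
  ultimately show "z \<in> (\<Union>y\<in>Y. orbit_closure act y)"
    by blast
qed

lemma open_star:
  assumes "open_covering \<U>"
  shows "open (star x \<U>)"
  using assms unfolding open_covering_def star_def by auto

lemma mem_star_self: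
  assumes "open_covering \<U>"
  shows "x \<in> star x \<U>"
proof -
  have "x \<in> \<Union>\<U>"
    using assms by (simp add: open_covering_def)
  then show ?thesis
    by (auto simp: star_def)
qed

lemma continuous_on_semigroup_action:
  assumes "semigroup_action act"
  shows "continuous_on A (act s)"
proof -
  have "continuous_on UNIV (\<lambda>(s, x). act s x)"
    using assms by (simp add: semigroup_action_def)
  then have "continuous_on A (\<lambda>x. (\<lambda>(s, x). act s x) (s, x))"
    by (rule continuous_on_compose2) (auto intro!: continuous_intros)
  then show ?thesis
    by simp
qed

text \<open>
  Continuity of the action of a single \<open>s\<close> moves the limit points of the orbit of \<open>x\<close> to limit
  points of that orbit, so an orbit closure is invariant and contains the orbits of its points.
\<close>
lemma orbit_closure_antimono:
  assumes act: "semigroup_action act" and y: "y \<in> orbit_closure act x"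
  shows "orbit_closure act y \<subseteq> orbit_closure act x"
proof -
  have "act s y \<in> orbit_closure act x" for s
  proof -
    have "act s ` orbit_set act {x} \<subseteq> orbit_set act {x}"
      using act unfolding orbit_set_def semigroup_action_def by blast
    then have "act s ` orbit_set act {x} \<subseteq> orbit_closure act x"
      unfolding orbit_closure_def using closure_subset by blast
    then have "act s ` closure (orbit_set act {x}) \<subseteq> orbit_closure act x"
      using continuous_on_semigroup_action[OF act]
      by (intro image_closure_subset) (auto simp: orbit_closure_def)
    then show ?thesis
      using y unfolding orbit_closure_def by blast
  qed
  then have "orbit_set act {y} \<subseteq> orbit_closure act x"
    unfolding orbit_set_def by blast
  then show ?thesis
    unfolding orbit_closure_def by (simp add: closure_minimal)
qed

text \<open>
  In a regular space \<open>K\<close> and the closed set \<open>- V\<close> have disjoint open neighbourhoods \<open>W\<close> and \<open>W'\<close>;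
  then \<open>closure W\<close> avoids \<open>W'\<close>, hence \<open>- V\<close>.
\<close>
lemma compact_shrink_open_neighbourhood:
  fixes K V :: "'x::topological_space set"
  assumes "regular_space (euclidean :: 'x topology)"
    and "compact K" "open V" "K \<subseteq> V"
  obtains W where "open W" "K \<subseteq> W" "closure W \<subseteq> V"
proof -
  have "compactin euclidean K" "closedin euclidean (- V)" "disjnt K (- V)"
    using assms by (auto simp: closed_Compl disjnt_def)
  then have "\<exists>W W'. openin euclidean W \<and> openin euclidean W' \<and> K \<subseteq> W \<and> - V \<subseteq> W' \<and> disjnt W W'"
    by (rule regular_space_compact_closed_separation[OF assms(1)])
  then obtain W W' where "openin euclidean W" "openin euclidean W'"
      and sep: "K \<subseteq> W" "- V \<subseteq> W'" "disjnt W W'"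
    by (elim exE conjE)
  then have "open W" "closed (- W')"
    by auto
  moreover have "closure W \<subseteq> - W'"
    using \<open>closed (- W')\<close> sep by (intro closure_minimal) (auto simp: disjnt_def)
  ultimately show thesis
    using that sep by blast
qed

text \<open>
  Semicontinuity is used at the points \<open>y\<close> of the orbit closure, not at \<open>x\<close>, since the stars in the
  definition of stability are centred there; invariance supplies \<open>K y \<subseteq> V\<close> for them.
\<close>
lemma upper_semicontinuous_imp_stable:
  assumes adm: "admissible \<O>" and act: "semigroup_action act"
    and usc: "\<And>y. y \<in> orbit_closure act x \<Longrightarrow> upper_semicontinuous_at (orbit_closure act) y"
  shows "stable act \<O> (orbit_closure act x)"
  unfolding stable_def
proof (intro allI impI ballI)
  fix U y
  assume U: "orbit_closure act x \<subseteq> interior U" and y: "y \<in> orbit_closure act x"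
  have "orbit_closure act y \<subseteq> interior U"
    using orbit_closure_antimono[OF act y] U by blast
  then obtain N where N: "y \<in> interior N" "\<And>z. z \<in> N \<Longrightarrow> orbit_closure act z \<subseteq> interior U"
    using usc[OF y] unfolding upper_semicontinuous_at_def by (meson open_interior)
  then obtain \<U> where "\<U> \<in> \<O>" and star: "star y \<U> \<subseteq> interior N"
    using adm unfolding admissible_def by (meson open_interior)
  have "orbit_set act (star y \<U>) \<subseteq> (\<Union>z\<in>star y \<U>. orbit_closure act z)"
    by (rule orbit_set_subset_orbit_closures)
  also have "\<dots> \<subseteq> U"
    using star N(2) interior_subset by blast
  finally show "\<exists>\<U>\<in>\<O>. orbit_set act (star y \<U>) \<subseteq> U"
    using \<open>\<U> \<in> \<O>\<close> by blast
qed

text \<open>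
  Stability provides stars only around points of \<open>K x\<close>, so the star around \<open>x\<close> that serves as the
  neighbourhood in semicontinuity is available because \<open>x \<in> K x\<close>.
\<close>
lemma stable_imp_upper_semicontinuous:
  fixes act :: "'s \<Rightarrow> 'x::topological_space \<Rightarrow> 'x"
  assumes reg: "regular_space (euclidean :: 'x topology)"
    and cov: "\<And>\<U>. \<U> \<in> \<O> \<Longrightarrow> open_covering \<U>"
    and comp: "compact (orbit_closure act x)"
    and x: "x \<in> orbit_closure act x"
    and stable: "stable act \<O> (orbit_closure act x)"
  shows "upper_semicontinuous_at (orbit_closure act) x"
  unfolding upper_semicontinuous_at_def
proof (intro allI impI)
  fix V :: "'x set"
  assume "open V \<and> orbit_closure act x \<subseteq> V"
  then have "open V" "orbit_closure act x \<subseteq> V"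
    by auto
  then obtain W where "open W" "orbit_closure act x \<subseteq> W" and W: "closure W \<subseteq> V"
    by (rule compact_shrink_open_neighbourhood[OF reg comp])
  moreover have "interior W = W"
    using \<open>open W\<close> by (rule interior_open)
  ultimately have "\<exists>\<U>\<in>\<O>. orbit_set act (star x \<U>) \<subseteq> W"
    using stable x unfolding stable_def by simp
  then obtain \<U> where "\<U> \<in> \<O>" and orbit: "orbit_set act (star x \<U>) \<subseteq> W"
    by blast
  have "orbit_closure act y \<subseteq> V" if "y \<in> star x \<U>" for y
  proof -
    have "orbit_set act {y} \<subseteq> W"
      using orbit_set_mono[of "{y}" "star x \<U>" act] that orbit by blast
    then show ?thesis
      using closure_mono[of "orbit_set act {y}" W] W unfolding orbit_closure_def by simp
  qed
  moreover have "x \<in> interior (star x \<U>)"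
    using cov[OF \<open>\<U> \<in> \<O>\<close>] by (simp add: interior_open open_star mem_star_self)
  ultimately show "\<exists>U. x \<in> interior U \<and> (\<forall>y\<in>U. orbit_closure act y \<subseteq> V)"
    by blast
qed

theorem theorem10:
  fixes act :: "'s::topological_semigroup_mult \<Rightarrow> 'x::topological_space \<Rightarrow> 'x"
    and \<O> :: "'x set set set"
  assumes "completely_regular_space (euclidean :: 'x topology)"
    and "admissible \<O>"
    and "semigroup_action act"
    and "\<And>x. orbit_closure act x \<noteq> {} \<and> compact (orbit_closure act x)"
    and "\<And>x. prolongation act \<O> x \<noteq> {} \<and> compact (prolongation act \<O> x)"
  shows "((\<forall>x. upper_semicontinuous_at (orbit_closure act) x)
            \<longrightarrow> (\<forall>x. stable act \<O> (orbit_closure act x)))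
       \<and> ((\<forall>x. x \<in> orbit_closure act x)
            \<longrightarrow> (\<forall>x. stable act \<O> (orbit_closure act x))
            \<longrightarrow> (\<forall>x. upper_semicontinuous_at (orbit_closure act) x))"
proof (intro conjI impI allI)
  fix x
  assume "\<forall>x. upper_semicontinuous_at (orbit_closure act) x"
  then show "stable act \<O> (orbit_closure act x)"
    by (simp add: upper_semicontinuous_imp_stable[OF assms(2,3)])
next
  fix x
  assume self: "\<forall>x. x \<in> orbit_closure act x"
    and stable: "\<forall>x. stable act \<O> (orbit_closure act x)"
  show "upper_semicontinuous_at (orbit_closure act) x"
  proof (rule stable_imp_upper_semicontinuous)
    show "regular_space (euclidean :: 'x topology)"
      using assms(1) by (rule completely_regular_imp_regular_space)
    show "open_covering \<U>" if "\<U> \<in> \<O>" for \<U>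
      using assms(2) that by (simp add: admissible_def)
    show "compact (orbit_closure act x)"
      using assms(4)[of x] by (rule conjunct2)
    show "x \<in> orbit_closure act x" "stable act \<O> (orbit_closure act x)"
      using self stable by simp_all
  qed
qed

end
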